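(* There exist absolute constants $c_1, c_2 > 0$ and irreducible reversible Markov chains $(V,P,\pi)$ with $|V|$ arbitrarily large such that \[ \lambda_2(I-P) \le c_1 \frac{\log |V|}{|V|^2} \quad \text{and} \quad \varphi_{\frac12}(P) \ge c_2 \frac{\log |V|}{|V|}. \] Consequently, for these chains $\lambda_2(I-P) \lesssim \dfrac{\big(\varphi_{\frac12}(P)\big)^2}{\log\big(1/\varphi_{\frac12}(P)\big)}$, where $\lesssim$ hides an absolute constant.
   Context: A Markov chain $(V,P,\pi)$ consists of a finite state set $V$, a transition matrix $P \in \mathbb{R}^{V\times V}$ (nonnegative entries, rows summing to $1$) and a stationary distribution $\pi$ ($\pi^T P = \pi^T$); it is irreducible if its transition graph is strongly connected and reversible if $\pi(u)P(u,v) = \pi(v)P(v,u)$ for all $u,v$. For a reversible chain, $I-P$ has real eigenvalues $0=\lambda_1 \le \lambda_2 \le \dots$; $\lambda_2(I-P)$ denotes the second smallest. For $S \subseteq V$ write $\pi(S) = \sum_{v\in S}\pi(v)$, $\overline{S} = V\setminus S$, $P(v,T) = \sum_{u\in T}P(v,u)$. For $p \in (0,1]$ the isoperimetric constant is \[ \varphi_p(P) = \min_{S \subset V,\ S\neq\emptyset,\ \pi(S)\le \frac12} \frac{\sum_{v\in S}\pi(v)\, P(v,\overline{S})^p}{\pi(S)}. \] Logarithms are natural. *)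

theory Defs
  imports
    Complex_Main
    "HOL-Library.Multiset"
    "HOL-Computational_Algebra.Polynomial"
    "Jordan_Normal_Form.Char_Poly"
begin

(* The values of P and \<pi> outside V are irrelevant everywhere below. *)

locale markov_chain =
  fixes V :: "'a set" and P :: "'a \<Rightarrow> 'a \<Rightarrow> real" and \<pi> :: "'a \<Rightarrow> real"
  assumes finite_states: "finite V"
    and trans_nonneg: "\<And>u v. u \<in> V \<Longrightarrow> v \<in> V \<Longrightarrow> 0 \<le> P u v"
    and trans_row_sum: "\<And>u. u \<in> V \<Longrightarrow> (\<Sum>v\<in>V. P u v) = 1"
    and distr_nonneg: "\<And>v. v \<in> V \<Longrightarrow> 0 \<le> \<pi> v"
    and distr_sum: "(\<Sum>v\<in>V. \<pi> v) = 1"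
    and stationary: "\<And>v. v \<in> V \<Longrightarrow> (\<Sum>u\<in>V. \<pi> u * P u v) = \<pi> v"

definition transition_graph :: "'a set \<Rightarrow> ('a \<Rightarrow> 'a \<Rightarrow> real) \<Rightarrow> ('a \<times> 'a) set" where
  "transition_graph V P = {(u, v). u \<in> V \<and> v \<in> V \<and> P u v > 0}"

definition irreducible_chain :: "'a set \<Rightarrow> ('a \<Rightarrow> 'a \<Rightarrow> real) \<Rightarrow> bool" where
  "irreducible_chain V P \<longleftrightarrow> (\<forall>u\<in>V. \<forall>v\<in>V. (u, v) \<in> (transition_graph V P)\<^sup>*)"

definition reversible_chain ::
  "'a set \<Rightarrow> ('a \<Rightarrow> 'a \<Rightarrow> real) \<Rightarrow> ('a \<Rightarrow> real) \<Rightarrow> bool" where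
  "reversible_chain V P \<pi> \<longleftrightarrow> (\<forall>u\<in>V. \<forall>v\<in>V. \<pi> u * P u v = \<pi> v * P v u)"

(* The linear order on states only serves to index rows and columns; the
   characteristic polynomial does not depend on it. *)
definition transition_mat :: "'a::linorder set \<Rightarrow> ('a \<Rightarrow> 'a \<Rightarrow> real) \<Rightarrow> real mat" where
  "transition_mat V P =
     mat (card V) (card V)
       (\<lambda>(i, j). P (sorted_list_of_set V ! i) (sorted_list_of_set V ! j))"

(* Real eigenvalues in increasing order, repeated according to their algebraic multiplicity. *)
definition sorted_eigenvalues :: "real mat \<Rightarrow> real list" where
  "sorted_eigenvalues A = sorted_list_of_multiset (proots (char_poly A))"

(* Lists are indexed from 0. Meaningful if A has at least two real eigenvalues, which holds
   for A = I - P with P reversible and irreducible on at least two states. *)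
definition lambda2 :: "real mat \<Rightarrow> real" where
  "lambda2 A = sorted_eigenvalues A ! 1"

(* The feasible sets S are automatically proper subsets of V, since \<pi>(V) = 1. For an
   irreducible chain on at least two states, feasible sets exist and satisfy \<pi>(S) > 0. *)
definition isoperimetric_const ::
  "real \<Rightarrow> 'a set \<Rightarrow> ('a \<Rightarrow> 'a \<Rightarrow> real) \<Rightarrow> ('a \<Rightarrow> real) \<Rightarrow> real" where
  "isoperimetric_const p V P \<pi> =
     Min {(\<Sum>v\<in>S. \<pi> v * (\<Sum>u\<in>V - S. P v u) powr p) / (\<Sum>v\<in>S. \<pi> v) | S.
            S \<subseteq> V \<and> S \<noteq> {} \<and> (\<Sum>v\<in>S. \<pi> v) \<le> 1 / 2}"

end

theory Submission
  imports
    "HOL-Analysis.Harmonic_Numbers"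
    "HOL-Library.Discrete_Functions"
    "HOL-Number_Theory.Cong"
    Defs
begin

text \<open>The chains are random walks on the cycle of length \<open>n\<close> whose jumps of length \<open>d\<close> have
  probability of order \<open>1 / d\<^sup>3\<close>. Constants and \<open>v \<mapsto> cos (2 * pi * v / n)\<close> are eigenvectors; the
  eigenvalue of the latter is at most of order \<open>(\<Sum>d. d\<^sup>2 / d\<^sup>3) / n\<^sup>2\<close>, which is of order \<open>ln n / n\<^sup>2\<close>.
  For the isoperimetric constant, consider windows of length \<open>2 * s\<close> with \<open>s \<le> sqrt n\<close>. If \<open>S\<close> never
  fills more than half of a window that starts in \<open>S\<close>, all its points escape with probability at
  least of order \<open>1 / s\<^sup>2\<close>, and this suffices. Otherwise some window is exactly half full, so \<open>s\<close>
  points of \<open>S\<close> escape with such a probability. If this happens for every \<open>s\<close>, the square roots of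
  the escape probabilities sum up to at least a harmonic sum.\<close>

section \<open>Elementary estimates\<close>

lemma sum_inverse_power_le_2:
  assumes "2 \<le> p"
  shows "(\<Sum>k=1..m. 1 / real k ^ p) \<le> 2"
proof -
  have "(\<Sum>k=1..m. 1 / real k ^ p) \<le> 2 - 1 / real m" if "1 \<le> m"
    using that
  proof (induction m rule: dec_induct)
    case (step m)
    have "real m * real (Suc m) \<le> real (Suc m) ^ 2"
      by (simp add: power2_eq_square)
    also have "\<dots> \<le> real (Suc m) ^ p"
      using assms by (intro power_increasing) auto
    finally have "1 / real (Suc m) ^ p \<le> 1 / (real m * real (Suc m))"
      using step by (intro divide_left_mono) auto
    also have "\<dots> = 1 / real m - 1 / real (Suc m)"
      using step by (simp add: field_simps)
    finally show ?case
      using step by simp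
  qed simp
  then show ?thesis
    by (cases "m = 0") (auto intro: order_trans)
qed

lemma one_minus_cos_le: "1 - cos x \<le> x\<^sup>2 / 2" for x :: real
proof -
  have "1 - cos x = 2 * (sin (x / 2))\<^sup>2"
    using cos_double_sin[of "x / 2"] by simp
  also have "(sin (x / 2))\<^sup>2 \<le> (x / 2)\<^sup>2"
    using abs_sin_x_le_abs_x[of "x / 2"] by (simp only: abs_le_square_iff)
  finally show ?thesis
    by (simp add: power2_eq_square)
qed

lemma ln_over_square_le:
  fixes c x y :: real
  assumes "0 < c" "0 < x" "1 \<le> c * x" "1 \<le> ln x" and y: "c * (ln x / x) \<le> y" "y < 1"
  shows "ln x / x\<^sup>2 \<le> 2 / c\<^sup>2 * (y\<^sup>2 / ln (1 / y))"
proof -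
  have "0 < ln x"
    using \<open>1 \<le> ln x\<close> by linarith
  then have "0 < c * (ln x / x)"
    using assms by (intro mult_pos_pos divide_pos_pos)
  then have "0 < y"
    using y by linarith
  have "1 / y \<le> 1 / (c * (ln x / x))"
    using y \<open>0 < c * (ln x / x)\<close> by (intro frac_le) auto
  also have "\<dots> = x * (1 / (c * ln x))"
    by simp
  also have "\<dots> \<le> x * x"
  proof (rule mult_left_mono)
    have "1 * 1 \<le> (c * x) * ln x"
      using assms by (intro mult_mono) auto
    then show "1 / (c * ln x) \<le> x"
      using \<open>0 < c\<close> \<open>0 < ln x\<close> by (simp add: pos_divide_le_eq mult.left_commute mult.assoc)
  qed (use \<open>0 < x\<close> in simp)
  finally have "ln (1 / y) \<le> ln (x * x)"
    using \<open>0 < x\<close> \<open>0 < y\<close> by (subst ln_le_cancel_iff) auto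
  then have ln_le: "ln (1 / y) \<le> 2 * ln x"
    using \<open>0 < x\<close> by (simp add: ln_mult)
  have "0 < ln (1 / y)"
    using y \<open>0 < y\<close> by (intro ln_gt_zero) simp
  have "ln x / x\<^sup>2 = 2 / c\<^sup>2 * ((c * (ln x / x))\<^sup>2 / (2 * ln x))"
    using assms by (simp add: field_simps power2_eq_square)
  also have "\<dots> \<le> 2 / c\<^sup>2 * (y\<^sup>2 / ln (1 / y))"
    using y ln_le \<open>0 < ln (1 / y)\<close> \<open>0 < c * (ln x / x)\<close>
    by (intro mult_left_mono frac_le power_mono) auto
  finally show ?thesis .
qed

lemma one_le_ln:
  assumes "3 \<le> n"
  shows "1 \<le> ln (real n)"
proof -
  have "exp 1 \<le> real n"
    using exp_le assms by linarith
  then show ?thesis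
    using assms by (simp add: ln_ge_iff)
qed

lemma harm_le_one_plus_ln: "0 < n \<Longrightarrow> harm n \<le> 1 + ln (real n)"
  using euler_mascheroni_sequence_decreasing[of 1 n] by (simp add: harm_expand)

lemma double_floor_sqrt_le:
  assumes "2 \<le> n"
  shows "2 * floor_sqrt n \<le> n"
proof (cases "2 \<le> floor_sqrt n")
  case True
  then have "2 * floor_sqrt n \<le> (floor_sqrt n)\<^sup>2"
    by (simp add: power2_eq_square)
  also have "\<dots> \<le> n"
    by simp
  finally show ?thesis .
qed (use assms in simp)

lemma ln_le_ln_floor_sqrt:
  assumes "0 < n"
  shows "ln (real n) \<le> 2 * ln (real (floor_sqrt n) + 1)"
proof -
  have "real n \<le> (real (Suc (floor_sqrt n)))\<^sup>2"
    using Suc_floor_sqrt_power2_gt[of n] by (metis less_imp_le of_nat_le_iff of_nat_power)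
  then have "ln (real n) \<le> ln ((real (Suc (floor_sqrt n)))\<^sup>2)"
    using assms by (subst ln_le_cancel_iff) auto
  then show ?thesis
    by (simp add: ln_realpow add.commute)
qed

lemma mult_ln_le_if_le_floor_sqrt:
  assumes "0 < n" "s \<le> floor_sqrt n"
  shows "real s * ln (real n) \<le> 2 * real n"
proof -
  have "ln (real n) \<le> 2 * real (floor_sqrt n)"
    using ln_le_ln_floor_sqrt[OF \<open>0 < n\<close>] ln_add_one_self_le_self[of "real (floor_sqrt n)"]
    by (simp add: add.commute)
  then have "real s * ln (real n) \<le> real (floor_sqrt n) * (2 * real (floor_sqrt n))"
    using assms by (intro mult_mono) auto
  also have "\<dots> = 2 * real ((floor_sqrt n)\<^sup>2)"
    by (simp add: power2_eq_square)
  also have "\<dots> \<le> 2 * real n"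
    by (simp only: mult_le_cancel_left_pos zero_less_numeral of_nat_le_iff floor_sqrt_power2_le)
  finally show ?thesis .
qed

section \<open>Sums over the cycle\<close>

lemma bij_betw_add_mod: "bij_betw (\<lambda>x. (u + x) mod n) {..<n} {..<n::nat}"
proof -
  have "inj_on (\<lambda>x. (u + x) mod n) {..<n}"
    by (rule inj_onI) (metis cong_add_lcancel_nat cong_def lessThan_iff mod_less)
  moreover have "(\<lambda>x. (u + x) mod n) ` {..<n} \<subseteq> {..<n}"
    by auto
  ultimately show ?thesis
    by (simp add: bij_betw_def endo_inj_surj)
qed

lemma sum_add_mod: "(\<Sum>x<n. F ((u + x) mod n)) = (\<Sum>x<n::nat. F x)"
  by (rule sum.reindex_bij_betw[OF bij_betw_add_mod])

lemma sum_reflect: "(\<Sum>d=1..<n. F (n - d)) = (\<Sum>d=1..<n::nat. F d)"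
  by (rule sum.reindex_bij_witness[of _ "\<lambda>d. n - d" "\<lambda>d. n - d"]) auto

lemma sum_lessThan_head: "0 < n \<Longrightarrow> (\<Sum>d<n::nat. F d) = F 0 + (\<Sum>d=1..<n. F d)"
  by (simp add: lessThan_atLeast0 sum.atLeast_Suc_lessThan)

section \<open>Superlevel sets\<close>

definition superlevel :: "'a set \<Rightarrow> ('a \<Rightarrow> real) \<Rightarrow> real \<Rightarrow> 'a set" where
  "superlevel S h t = {v \<in> S. t \<le> h v}"

lemma sum_le_sum_if_card_superlevel_ge:
  fixes h :: "'a \<Rightarrow> real" and t :: "nat \<Rightarrow> real"
  assumes "finite S" and h_nonneg: "\<And>v. v \<in> S \<Longrightarrow> 0 \<le> h v"
    and card_superlevel: "\<And>s. 1 \<le> s \<Longrightarrow> s \<le> m \<Longrightarrow> s \<le> card (superlevel S h (t s))"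
  shows "(\<Sum>s=1..m. t s) \<le> sum h S"
proof -
  have "\<exists>A\<subseteq>S. card A = m \<and> (\<Sum>s=1..m. t s) \<le> sum h A"
    using card_superlevel
  proof (induction m)
    case (Suc m)
    then obtain A where A: "A \<subseteq> S" "card A = m" "(\<Sum>s=1..m. t s) \<le> sum h A"
      by (meson le_SucI)
    have "finite A"
      using A \<open>finite S\<close> finite_subset by blast
    have "card A < card (superlevel S h (t (Suc m)))"
      using Suc.prems[of "Suc m"] A by simp
    then have "\<not> superlevel S h (t (Suc m)) \<subseteq> A"
      using card_mono[OF \<open>finite A\<close>] by (meson leD)
    then obtain v where "v \<in> S" "t (Suc m) \<le> h v" "v \<notin> A"
      by (auto simp: superlevel_def)
    with A \<open>finite A\<close> show ?case
      by (intro exI[of _ "insert v A"]) auto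
  qed (auto intro: exI[of _ "{}"])
  then obtain A where "A \<subseteq> S" "(\<Sum>s=1..m. t s) \<le> sum h A"
    by blast
  then show ?thesis
    using sum_mono2[of S A h] \<open>finite S\<close> h_nonneg by fastforce
qed

lemma sum_ge_ln_if_card_superlevel:
  fixes h :: "'a \<Rightarrow> real"
  assumes "finite S" "0 < n" "card S \<le> n" "0 \<le> b" and h_nonneg: "\<And>v. v \<in> S \<Longrightarrow> 0 \<le> h v"
    and dichotomy: "\<And>s. 1 \<le> s \<Longrightarrow> s \<le> floor_sqrt n
      \<Longrightarrow> superlevel S h (b / real s) = S \<or> s \<le> card (superlevel S h (b / real s))"
  shows "b / 2 * (ln (real n) / real n) * real (card S) \<le> sum h S"
proof (cases "\<exists>s. 1 \<le> s \<and> s \<le> floor_sqrt n \<and> superlevel S h (b / real s) = S")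
  case True
  then obtain s where s: "1 \<le> s" "s \<le> floor_sqrt n" "\<And>v. v \<in> S \<Longrightarrow> b / real s \<le> h v"
    unfolding superlevel_def by blast
  have "ln (real n) / (2 * real n) \<le> 1 / real s"
    using mult_ln_le_if_le_floor_sqrt[OF \<open>0 < n\<close> s(2)] s \<open>0 < n\<close> by (simp add: field_simps)
  then have "b * (ln (real n) / (2 * real n)) * real (card S) \<le> b * (1 / real s) * real (card S)"
    using \<open>0 \<le> b\<close> by (intro mult_right_mono mult_left_mono) auto
  also have "\<dots> = (\<Sum>v\<in>S. b / real s)"
    by simp
  also have "\<dots> \<le> sum h S"
    using s by (intro sum_mono) auto
  finally show ?thesis
    by simp
next
  case False
  have "b / 2 * (ln (real n) / real n) * real (card S) \<le> b / 2 * (ln (real n) / real n) * real n"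
    using assms by (intro mult_left_mono) auto
  also have "\<dots> = b * (ln (real n) / 2)"
    using \<open>0 < n\<close> by simp
  also have "\<dots> \<le> b * harm (floor_sqrt n)"
    using ln_le_ln_floor_sqrt[OF \<open>0 < n\<close>] harm_ge_ln[of "floor_sqrt n"] \<open>0 \<le> b\<close>
    by (intro mult_left_mono) auto
  also have "\<dots> = (\<Sum>s=1..floor_sqrt n. b / real s)"
    by (simp add: harm_def sum_distrib_left divide_inverse)
  also have "\<dots> \<le> sum h S"
    using dichotomy False by (intro sum_le_sum_if_card_superlevel_ge \<open>finite S\<close> h_nonneg) blast+
  finally show ?thesis .
qed

section \<open>The second smallest eigenvalue\<close>

lemma sorted_nth_1_le:
  assumes "sorted xs" "x \<in> set xs" "y \<in> set xs" "x < y"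
  shows "xs ! 1 \<le> y"
proof -
  obtain i j where ij: "i < length xs" "xs ! i = x" "j < length xs" "xs ! j = y"
    using assms by (metis in_set_conv_nth)
  have "j \<noteq> 0"
    using ij assms by (metis leD sorted_nth_mono zero_le)
  then show ?thesis
    using ij sorted_nth_mono[OF \<open>sorted xs\<close>, of 1 j] by simp
qed

lemma lambda2_le:
  assumes A: "A \<in> carrier_mat n n" and "eigenvalue A x" "eigenvalue A y" "x < y"
  shows "lambda2 A \<le> y"
proof -
  have "char_poly A \<noteq> 0"
    using degree_monic_char_poly[OF A] by auto
  then have "set_mset (proots (char_poly A)) = {x. eigenvalue A x}"
    by (simp add: eigenvalue_root_char_poly[OF A])
  then show ?thesis
    unfolding lambda2_def sorted_eigenvalues_def using assms
    by (intro sorted_nth_1_le[of _ x]) (auto simp: sorted_sorted_list_of_multiset)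
qed

lemma transition_mat_carrier: "transition_mat V P \<in> carrier_mat (card V) (card V)"
  by (simp add: transition_mat_def)

lemma transition_mat_mult_vec:
  assumes "finite V"
  shows "transition_mat V P *\<^sub>v vec (card V) (\<lambda>i. f (sorted_list_of_set V ! i))
    = vec (card V) (\<lambda>i. \<Sum>v\<in>V. P (sorted_list_of_set V ! i) v * f v)"
proof -
  have "bij_betw ((!) (sorted_list_of_set V)) {0..<card V} V"
    using assms by (intro bij_betw_nth) (auto simp: lessThan_atLeast0)
  then have "(\<Sum>j=0..<card V. P u (sorted_list_of_set V ! j) * f (sorted_list_of_set V ! j))
      = (\<Sum>v\<in>V. P u v * f v)" for u
    by (rule sum.reindex_bij_betw)
  then show ?thesis
    by (intro eq_vecI) (auto simp: transition_mat_def scalar_prod_def)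
qed

lemma eigenvalue_laplacian:
  fixes f :: "'a::linorder \<Rightarrow> real"
  assumes "finite V" and eigenfunction: "\<And>u. u \<in> V \<Longrightarrow> (\<Sum>v\<in>V. P u v * f v) = (1 - \<mu>) * f u"
    and "w \<in> V" "f w \<noteq> 0"
  shows "eigenvalue (1\<^sub>m (card V) - transition_mat V P) \<mu>"
proof -
  define x where "x = vec (card V) (\<lambda>i. f (sorted_list_of_set V ! i))"
  have x: "x \<in> carrier_vec (card V)"
    by (simp add: x_def)
  have nth_mem: "sorted_list_of_set V ! i \<in> V" if "i < card V" for i
    using that \<open>finite V\<close> by (metis nth_mem length_sorted_list_of_set set_sorted_list_of_set)
  have "(1\<^sub>m (card V) - transition_mat V P) *\<^sub>v x = x - transition_mat V P *\<^sub>v x"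
    using x minus_mult_distrib_mat_vec[OF one_carrier_mat transition_mat_carrier x] by simp
  also have "\<dots> = \<mu> \<cdot>\<^sub>v x"
    unfolding x_def transition_mat_mult_vec[OF \<open>finite V\<close>]
    by (intro eq_vecI) (auto simp: eigenfunction[OF nth_mem] left_diff_distrib)
  finally have "(1\<^sub>m (card V) - transition_mat V P) *\<^sub>v x = \<mu> \<cdot>\<^sub>v x" .
  moreover obtain i where "i < card V" "sorted_list_of_set V ! i = w"
    using \<open>w \<in> V\<close> \<open>finite V\<close>
    by (metis in_set_conv_nth length_sorted_list_of_set set_sorted_list_of_set)
  then have "x \<noteq> 0\<^sub>v (card V)"
    using \<open>f w \<noteq> 0\<close> unfolding x_def by (metis index_vec index_zero_vec(1))
  ultimately show ?thesis
    unfolding eigenvalue_def eigenvector_def using x transition_mat_carrier[of V P] by auto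
qed

lemma lambda2_laplacian_le:
  fixes f :: "'a::linorder \<Rightarrow> real"
  assumes "markov_chain V P \<pi>" and "\<And>u. u \<in> V \<Longrightarrow> (\<Sum>v\<in>V. P u v * f v) = (1 - \<mu>) * f u"
    and "w \<in> V" "f w \<noteq> 0" and "0 < \<mu>"
  shows "lambda2 (1\<^sub>m (card V) - transition_mat V P) \<le> \<mu>"
proof -
  interpret markov_chain V P \<pi>
    by fact
  show ?thesis
  proof (rule lambda2_le)
    show "1\<^sub>m (card V) - transition_mat V P \<in> carrier_mat (card V) (card V)"
      by (intro minus_carrier_mat transition_mat_carrier)
    show "eigenvalue (1\<^sub>m (card V) - transition_mat V P) 0"
      using \<open>w \<in> V\<close>
      by (intro eigenvalue_laplacian[where f = "\<lambda>_. 1"]) (auto simp: finite_states trans_row_sum)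
    show "eigenvalue (1\<^sub>m (card V) - transition_mat V P) \<mu>"
      by (rule eigenvalue_laplacian[OF finite_states assms(2-4)])
  qed fact
qed

section \<open>The isoperimetric constant\<close>

definition escape_prob :: "'a set \<Rightarrow> ('a \<Rightarrow> 'a \<Rightarrow> real) \<Rightarrow> 'a set \<Rightarrow> 'a \<Rightarrow> real" where
  "escape_prob V P S v = (\<Sum>u\<in>V - S. P v u)"

definition cut_ratio ::
  "real \<Rightarrow> 'a set \<Rightarrow> ('a \<Rightarrow> 'a \<Rightarrow> real) \<Rightarrow> ('a \<Rightarrow> real) \<Rightarrow> 'a set \<Rightarrow> real" where
  "cut_ratio p V P \<pi> S = (\<Sum>v\<in>S. \<pi> v * escape_prob V P S v powr p) / (\<Sum>v\<in>S. \<pi> v)"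

definition feasible_cuts :: "'a set \<Rightarrow> ('a \<Rightarrow> real) \<Rightarrow> 'a set set" where
  "feasible_cuts V \<pi> = {S. S \<subseteq> V \<and> S \<noteq> {} \<and> (\<Sum>v\<in>S. \<pi> v) \<le> 1 / 2}"

lemma finite_feasible_cuts: "finite V \<Longrightarrow> finite (feasible_cuts V \<pi>)"
  by (rule finite_subset[of _ "Pow V"]) (auto simp: feasible_cuts_def)

lemma isoperimetric_const_eq_Min:
  "isoperimetric_const p V P \<pi> = Min (cut_ratio p V P \<pi> ` feasible_cuts V \<pi>)"
  unfolding isoperimetric_const_def cut_ratio_def escape_prob_def feasible_cuts_def
  by (intro arg_cong[of _ _ Min]) auto

lemma isoperimetric_const_less_1:
  assumes "markov_chain V P \<pi>" "v \<in> V" "0 < \<pi> v" "\<pi> v \<le> 1 / 2" "0 < P v v" "0 < p"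
  shows "isoperimetric_const p V P \<pi> < 1"
proof -
  interpret markov_chain V P \<pi>
    by fact
  have "{v} \<in> feasible_cuts V \<pi>"
    using assms by (auto simp: feasible_cuts_def)
  then have "isoperimetric_const p V P \<pi> \<le> cut_ratio p V P \<pi> {v}"
    unfolding isoperimetric_const_eq_Min by (simp add: finite_feasible_cuts finite_states)
  also have "\<dots> = escape_prob V P {v} v powr p"
    using assms by (simp add: cut_ratio_def)
  also have "\<dots> < 1 powr p"
  proof (rule powr_less_mono2)
    show "0 \<le> escape_prob V P {v} v"
      using \<open>v \<in> V\<close> by (auto simp: escape_prob_def intro!: sum_nonneg trans_nonneg)
    show "escape_prob V P {v} v < 1"
      using assms by (simp add: escape_prob_def sum_diff1 finite_states trans_row_sum)
  qed fact
  finally show ?thesis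
    by simp
qed

lemma isoperimetric_const_uniform_ge:
  assumes "finite V" "2 \<le> card V"
    and escape_ge: "\<And>S. S \<subseteq> V \<Longrightarrow> 2 * card S \<le> card V
      \<Longrightarrow> c * real (card S) \<le> (\<Sum>v\<in>S. escape_prob V P S v powr p)"
  shows "c \<le> isoperimetric_const p V P (\<lambda>_. 1 / real (card V))"
  unfolding isoperimetric_const_eq_Min
proof (rule Min.boundedI)
  let ?\<pi> = "\<lambda>_. 1 / real (card V)"
  obtain v where "v \<in> V"
    using assms by fastforce
  then have "{v} \<in> feasible_cuts V ?\<pi>"
    using assms by (auto simp: feasible_cuts_def)
  then show "cut_ratio p V P ?\<pi> ` feasible_cuts V ?\<pi> \<noteq> {}"
    by blast
  fix a assume "a \<in> cut_ratio p V P ?\<pi> ` feasible_cuts V ?\<pi>"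
  then obtain S where S: "S \<subseteq> V" "S \<noteq> {}" "real (card S) / real (card V) \<le> 1 / 2"
    and a: "a = cut_ratio p V P ?\<pi> S"
    by (auto simp: feasible_cuts_def)
  have "0 < card S"
    using S \<open>finite V\<close> by (metis card_gt_0_iff finite_subset)
  moreover have "2 * card S \<le> card V"
    using S \<open>2 \<le> card V\<close> by (simp add: field_simps)
  moreover have "a = (\<Sum>v\<in>S. escape_prob V P S v powr p) / real (card S)"
    using \<open>2 \<le> card V\<close> by (simp add: a cut_ratio_def flip: sum_divide_distrib)
  ultimately show "c \<le> a"
    using escape_ge[OF S(1)] by (simp add: pos_le_divide_eq)
qed (use assms finite_feasible_cuts in auto)

section \<open>Symmetric walks on the cycle\<close>

definition circulant :: "nat \<Rightarrow> (nat \<Rightarrow> real) \<Rightarrow> nat \<Rightarrow> nat \<Rightarrow> real" where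
  "circulant n jump u v = jump ((v + n - u) mod n)"

lemma circulant_shift:
  assumes "u < n" "d < n"
  shows "circulant n jump u ((u + d) mod n) = jump d"
proof (cases "u + d < n")
  case False
  then have "(u + d) mod n = u + d - n"
    using assms by (simp add: le_mod_geq)
  then show ?thesis
    using assms False by (simp add: circulant_def)
qed (use assms in \<open>simp add: circulant_def\<close>)

lemma sum_circulant:
  assumes "u < n"
  shows "(\<Sum>v<n. circulant n jump u v * F v) = (\<Sum>d<n. jump d * F ((u + d) mod n))"
  unfolding sum_add_mod[of "\<lambda>v. circulant n jump u v * F v" u n, symmetric]
  by (intro sum.cong) (auto simp: circulant_shift assms)

lemma irreducible_chain_circulant:
  assumes "1 < n" "0 < jump 1"
  shows "irreducible_chain {..<n} (circulant n jump)"
proof -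
  have reach: "(u, (u + k) mod n) \<in> (transition_graph {..<n} (circulant n jump))\<^sup>*"
    if "u < n" for u k
  proof (induction k)
    case (Suc k)
    have "circulant n jump ((u + k) mod n) ((u + Suc k) mod n) = jump 1"
      using circulant_shift[of "(u + k) mod n" n 1 jump] assms by (simp add: mod_Suc_eq)
    then have "((u + k) mod n, (u + Suc k) mod n) \<in> transition_graph {..<n} (circulant n jump)"
      using assms by (simp add: transition_graph_def)
    with Suc.IH show ?case
      by (rule rtrancl_into_rtrancl)
  qed (use that in simp)
  have "(u, v) \<in> (transition_graph {..<n} (circulant n jump))\<^sup>*" if "u < n" "v < n" for u v
    using reach[of u "v + n - u"] that by simp
  then show ?thesis
    by (simp add: irreducible_chain_def)
qed

locale symmetric_cyclic_walk =
  fixes n :: nat and jump :: "nat \<Rightarrow> real"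
  assumes n_pos: "0 < n"
    and jump_nonneg: "\<And>d. d < n \<Longrightarrow> 0 \<le> jump d"
    and sum_jump: "(\<Sum>d<n. jump d) = 1"
    and jump_reflect: "\<And>d. 0 < d \<Longrightarrow> d < n \<Longrightarrow> jump (n - d) = jump d"
begin

lemma circulant_nonneg: "0 \<le> circulant n jump u v"
  by (simp add: circulant_def jump_nonneg n_pos)

lemma circulant_sym:
  assumes "u < n" "v < n"
  shows "circulant n jump u v = circulant n jump v u"
  using assms
proof (induction u v rule: linorder_wlog)
  case (le u v)
  show ?case
  proof (cases "u = v")
    case False
    then have "0 < v - u" "v - u < n"
      using le by simp_all
    moreover have "v + n - u = (v - u) + n" "u + n - v = n - (v - u)"
      using le by simp_all
    ultimately show ?thesis
      using jump_reflect[of "v - u"] by (simp only: circulant_def mod_add_self2 mod_less diff_less)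
  qed simp
qed simp

lemma sum_circulant_row: "u < n \<Longrightarrow> (\<Sum>v<n. circulant n jump u v) = 1"
  using sum_circulant[of u n jump "\<lambda>_. 1"] sum_jump by simp

lemma markov_chain_circulant: "markov_chain {..<n} (circulant n jump) (\<lambda>_. 1 / real n)"
proof
  fix v assume "v \<in> {..<n}"
  then have "(\<Sum>u<n. circulant n jump u v) = (\<Sum>u<n. circulant n jump v u)"
    by (intro sum.cong) (auto simp: circulant_sym)
  then show "(\<Sum>u<n. 1 / real n * circulant n jump u v) = 1 / real n"
    using \<open>v \<in> {..<n}\<close> by (simp add: sum_circulant_row flip: sum_divide_distrib)
qed (use n_pos in \<open>auto simp: sum_circulant_row circulant_nonneg\<close>)

lemma reversible_chain_circulant: "reversible_chain {..<n} (circulant n jump) (\<lambda>_. 1 / real n)"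
  unfolding reversible_chain_def by (auto simp: circulant_sym)

end

section \<open>Spectral bound for symmetric cyclic walks\<close>

definition turn :: "nat \<Rightarrow> nat \<Rightarrow> real" where
  "turn n k = 2 * pi * real k / real n"

lemma turn_add: "turn n (k + l) = turn n k + turn n l"
  by (simp add: turn_def distrib_left add_divide_distrib)

lemma turn_mult_reflect: "d < n \<Longrightarrow> turn n (j * (n - d)) = real j * (2 * pi) - turn n (j * d)"
  by (simp add: turn_def of_nat_diff field_simps)

lemma cos_turn_mult_reflect: "d < n \<Longrightarrow> cos (turn n (j * (n - d))) = cos (turn n (j * d))"
  unfolding turn_mult_reflect using cos.plus_of_nat[of "- turn n (j * d)" j] by simp

lemma sin_turn_mult_reflect: "d < n \<Longrightarrow> sin (turn n (j * (n - d))) = - sin (turn n (j * d))"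
  unfolding turn_mult_reflect using sin.plus_of_nat[of "- turn n (j * d)" j] by simp

lemma cos_turn_mod: "cos (turn n (k mod n)) = cos (turn n k)"
proof (cases "n = 0")
  case False
  have "real k = real (k mod n) + real (k div n) * real n"
    by (metis mod_div_mult_eq of_nat_add of_nat_mult)
  then have "turn n k = turn n (k mod n) + real (k div n) * (2 * pi)"
    using False by (simp add: turn_def field_simps)
  then show ?thesis
    using cos.plus_of_nat[of "turn n (k mod n)" "k div n"] by simp
qed simp

lemma sum_one_minus_cos_turn_div_cube_le:
  "(\<Sum>d=1..<n. (1 - cos (turn n d)) / real d ^ 3) \<le> 2 * pi\<^sup>2 / (real n)\<^sup>2 * harm n"
proof -
  have "(1 - cos (turn n d)) / real d ^ 3 \<le> 2 * pi\<^sup>2 / (real n)\<^sup>2 * (1 / real d)"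
    if "d \<in> {1..<n}" for d
  proof -
    have "(1 - cos (turn n d)) / real d ^ 3 \<le> ((turn n d)\<^sup>2 / 2) / real d ^ 3"
      by (intro divide_right_mono one_minus_cos_le) simp
    also have "\<dots> = 2 * pi\<^sup>2 / (real n)\<^sup>2 * (1 / real d)"
      using that by (simp add: turn_def field_simps power2_eq_square power3_eq_cube)
    finally show ?thesis .
  qed
  then have "(\<Sum>d=1..<n. (1 - cos (turn n d)) / real d ^ 3)
      \<le> 2 * pi\<^sup>2 / (real n)\<^sup>2 * (\<Sum>d=1..<n. 1 / real d)"
    unfolding sum_distrib_left by (rule sum_mono)
  also have "\<dots> \<le> 2 * pi\<^sup>2 / (real n)\<^sup>2 * (\<Sum>d=1..n. 1 / real d)"
    by (intro mult_left_mono sum_mono2) auto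
  finally show ?thesis
    by (simp add: harm_def inverse_eq_divide)
qed

context symmetric_cyclic_walk
begin

lemma sum_jump_sin: "(\<Sum>d<n. jump d * sin (turn n (j * d))) = 0"
proof -
  have "(\<Sum>d=1..<n. jump d * sin (turn n (j * d)))
      = (\<Sum>d=1..<n. jump (n - d) * sin (turn n (j * (n - d))))"
    by (rule sum_reflect[symmetric])
  also have "\<dots> = - (\<Sum>d=1..<n. jump d * sin (turn n (j * d)))"
    unfolding sum_negf[symmetric]
    by (intro sum.cong) (auto simp: sin_turn_mult_reflect jump_reflect)
  finally show ?thesis
    using n_pos by (simp add: sum_lessThan_head turn_def)
qed

lemma circulant_cos:
  assumes "u < n"
  shows "(\<Sum>v<n. circulant n jump u v * cos (turn n (j * v)))
    = (\<Sum>d<n. jump d * cos (turn n (j * d))) * cos (turn n (j * u))"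
proof -
  have cos_sum: "cos (turn n (j * ((u + d) mod n)))
      = cos (turn n (j * u)) * cos (turn n (j * d)) - sin (turn n (j * u)) * sin (turn n (j * d))"
    for d
  proof -
    have "cos (turn n (j * ((u + d) mod n))) = cos (turn n (j * u + j * d))"
      by (metis cos_turn_mod mod_mult_right_eq distrib_left)
    then show ?thesis
      by (simp add: turn_add cos_add)
  qed
  have "(\<Sum>v<n. circulant n jump u v * cos (turn n (j * v)))
      = (\<Sum>d<n. jump d * cos (turn n (j * d))) * cos (turn n (j * u))
        - sin (turn n (j * u)) * (\<Sum>d<n. jump d * sin (turn n (j * d)))"
    unfolding sum_circulant[OF assms] sum_distrib_left sum_distrib_right sum_subtractf[symmetric]
    by (intro sum.cong) (simp_all only: cos_sum, simp add: algebra_simps)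
  then show ?thesis
    by (simp add: sum_jump_sin)
qed

lemma lambda2_circulant_le:
  assumes "1 < n" "0 < jump 1"
  shows "lambda2 (1\<^sub>m n - transition_mat {..<n} (circulant n jump))
    \<le> (\<Sum>d=1..<n. jump d * (1 - cos (turn n d)))"
    (is "_ \<le> ?\<mu>")
proof -
  have "(\<Sum>d<n. jump d * (1 - cos (turn n d))) = 1 - (\<Sum>d<n. jump d * cos (turn n d))"
    by (simp add: right_diff_distrib sum_subtractf sum_jump)
  then have "1 - ?\<mu> = (\<Sum>d<n. jump d * cos (turn n d))"
    using n_pos by (simp add: sum_lessThan_head turn_def)
  then have cos_eigenvector:
    "(\<Sum>v<n. circulant n jump u v * cos (turn n v)) = (1 - ?\<mu>) * cos (turn n u)"
    if "u < n" for u
    using circulant_cos[OF that, of 1] by simp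
  have "0 < sin (pi / real n)"
    using assms by (intro sin_gt_zero) (auto simp: field_simps)
  then have "cos (turn n 1) < 1"
    using cos_double_sin[of "pi / real n"] by (simp add: turn_def mult.assoc)
  then have "0 < ?\<mu>"
    using assms by (intro sum_pos2[where i = 1]) (auto simp: jump_nonneg)
  then show ?thesis
    using lambda2_laplacian_le[OF markov_chain_circulant, of "\<lambda>v. cos (turn n v)" ?\<mu> 0]
      cos_eigenvector n_pos by (simp add: turn_def)
qed

end

section \<open>Windows on the cycle\<close>

definition window :: "nat \<Rightarrow> nat \<Rightarrow> nat \<Rightarrow> nat set" where
  "window n r x = (\<lambda>i. (x + i) mod n) ` {..<r}"

lemma inj_on_window: "r \<le> n \<Longrightarrow> inj_on (\<lambda>i. (x + i) mod n) {..<r::nat}"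
  using bij_betw_add_mod[of x n] by (meson bij_betw_imp_inj_on inj_on_subset lessThan_subset_iff)

lemma card_window: "r \<le> n \<Longrightarrow> card (window n r x) = r"
  by (simp add: window_def card_image inj_on_window)

lemma finite_window: "finite (window n r x)"
  by (simp add: window_def)

lemma window_subset: "0 < n \<Longrightarrow> window n r x \<subseteq> {..<n}"
  by (auto simp: window_def)

lemma mem_window_self: "0 < r \<Longrightarrow> x < n \<Longrightarrow> x \<in> window n r x"
  by (auto simp: window_def intro!: image_eqI[of _ _ 0])

lemma window_add_period: "window n r (x + n) = window n r x"
proof -
  have "(x + n + i) mod n = (x + i) mod n" for i
    by (metis add.assoc add.commute mod_add_self2)
  then show ?thesis
    by (simp add: window_def)
qed

lemma insert_window_Suc:
  "insert (x mod n) (window n r (Suc x)) = insert ((x + r) mod n) (window n r x)"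
proof -
  have "insert (x mod n) (window n r (Suc x)) = (\<lambda>i. (x + i) mod n) ` insert 0 (Suc ` {..<r})"
    by (simp add: window_def image_image)
  also have "insert 0 (Suc ` {..<r}) = insert r {..<r}"
    by (metis lessThan_Suc lessThan_Suc_eq_insert_0)
  finally show ?thesis
    by (simp add: window_def)
qed

lemma card_window_Int_Suc:
  "\<bar>int (card (window n r (Suc x) \<inter> S)) - int (card (window n r x \<inter> S))\<bar> \<le> 1"
proof -
  have card_insert_Int: "card (W \<inter> S) \<le> card (insert a W \<inter> S)"
    "card (insert a W \<inter> S) \<le> Suc (card (W \<inter> S))" if "finite W" for a and W :: "nat set"
    using that by (auto simp: Int_insert_left card_insert_if)
  show ?thesis
    using card_insert_Int[OF finite_window[of n r "Suc x"], of "x mod n"]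
      card_insert_Int[OF finite_window[of n r x], of "(x + r) mod n"]
    unfolding insert_window_Suc by linarith
qed

lemma sum_card_window_Int:
  assumes "r \<le> n" "S \<subseteq> {..<n}"
  shows "(\<Sum>x<n. card (window n r x \<inter> S)) = r * card S"
proof -
  have card_Int: "card (W \<inter> S) = (\<Sum>y\<in>W. of_bool (y \<in> S))" if "finite W" for W
    using that by (simp add: sum.If_cases of_bool_def)
  have "card (window n r x \<inter> S) = (\<Sum>i<r. of_bool ((x + i) mod n \<in> S))" for x
    unfolding card_Int[OF finite_window]
    unfolding window_def sum.reindex[OF inj_on_window[OF assms(1)]]
    by simp
  then have "(\<Sum>x<n. card (window n r x \<inter> S)) = (\<Sum>i<r. \<Sum>x<n. of_bool ((i + x) mod n \<in> S))"
    by (simp only: add.commute[of _ x for x] sum.swap[of _ "{..<r}"])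
  also have "\<dots> = (\<Sum>i<r. card ({..<n} \<inter> S))"
    unfolding sum_add_mod[of "\<lambda>y. of_bool (y \<in> S)"] card_Int[OF finite_lessThan] ..
  also have "{..<n} \<inter> S = S"
    using assms by auto
  finally show ?thesis
    by simp
qed

text \<open>Sliding a window by one changes its number of points of \<open>S\<close> by at most one, so every
  value between the average and the maximum is attained.\<close>

lemma ex_card_window_Int_eq:
  assumes "0 < n" "r \<le> n" "S \<subseteq> {..<n}" "r * card S \<le> k * n" "k \<le> card (window n r v \<inter> S)"
  obtains x where "card (window n r x \<inter> S) = k"
proof -
  define filling where "filling x = card (window n r x \<inter> S)" for x
  have "\<exists>y<n. filling y \<le> k"
  proof (rule ccontr)
    assume "\<not> (\<exists>y<n. filling y \<le> k)"
    then have "(\<Sum>y<n. k) < (\<Sum>y<n. filling y)"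
      using assms by (intro sum_strict_mono) (auto simp: not_le)
    then show False
      using assms sum_card_window_Int[OF assms(2,3)] by (simp add: filling_def mult.commute)
  qed
  then obtain y where "y < n" "filling y \<le> k"
    by blast
  moreover have "k \<le> filling (v + n)"
    using assms by (simp add: filling_def window_add_period)
  ultimately have "\<exists>x. y \<le> x \<and> x \<le> v + n \<and> int (filling x) = int k"
    using card_window_Int_Suc by (intro nat_intermed_int_val) (auto simp: filling_def)
  then show ?thesis
    using that by (auto simp: filling_def)
qed

section \<open>Isoperimetry of symmetric cyclic walks\<close>

context symmetric_cyclic_walk
begin

abbreviation escape :: "nat set \<Rightarrow> nat \<Rightarrow> real" where
  "escape \<equiv> escape_prob {..<n} (circulant n jump)"

lemma circulant_window_ge:
  assumes jump_ge: "\<And>d. 0 < d \<Longrightarrow> d < r \<Longrightarrow> a \<le> jump d"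
    and "r \<le> n" "u \<in> window n r x" "v \<in> window n r x" "u \<noteq> v"
  shows "a \<le> circulant n jump u v"
proof -
  have forward: "a \<le> circulant n jump ((x + i) mod n) ((x + j) mod n)" if "i < j" "j < r" for i j
  proof -
    have "((x + i) mod n + (j - i)) mod n = (x + j) mod n"
      using that unfolding mod_add_left_eq by simp
    then have "circulant n jump ((x + i) mod n) ((x + j) mod n) = jump (j - i)"
      using circulant_shift[of "(x + i) mod n" n "j - i" jump] that \<open>r \<le> n\<close> by simp
    then show ?thesis
      using jump_ge[of "j - i"] that by simp
  qed
  obtain i j where ij: "i < r" "j < r" "u = (x + i) mod n" "v = (x + j) mod n"
    using assms by (auto simp: window_def)
  then have "circulant n jump u v = circulant n jump v u"
    using n_pos by (simp add: circulant_sym)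
  then show ?thesis
    using forward[of i j] forward[of j i] ij \<open>u \<noteq> v\<close> by (cases i j rule: linorder_cases) auto
qed

lemma escape_prob_window_ge:
  assumes jump_ge: "\<And>d. 0 < d \<Longrightarrow> d < 2 * s \<Longrightarrow> a \<le> jump d" and "0 \<le> a"
    and "2 * s \<le> n" "card (window n (2 * s) x \<inter> S) \<le> s" "v \<in> window n (2 * s) x \<inter> S"
  shows "real s * a \<le> escape S v"
proof -
  let ?W = "window n (2 * s) x"
  have "card (?W - S) + card (?W \<inter> S) = 2 * s"
    using card_Diff_subset_Int[of ?W S] card_window[OF \<open>2 * s \<le> n\<close>, of x] card_mono[of ?W "?W \<inter> S"]
    by (simp add: finite_window)
  then have "real s * a \<le> real (card (?W - S)) * a"
    using assms by (intro mult_right_mono) auto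
  also have "\<dots> = (\<Sum>u\<in>?W - S. a)"
    by simp
  also have "\<dots> \<le> (\<Sum>u\<in>?W - S. circulant n jump v u)"
    using assms by (intro sum_mono circulant_window_ge[of "2 * s" _ _ x]) auto
  also have "\<dots> \<le> escape S v"
    unfolding escape_prob_def using window_subset[OF n_pos]
    by (intro sum_mono2) (auto simp: circulant_nonneg)
  finally show ?thesis .
qed

lemma card_escape_prob_superlevel:
  assumes jump_ge: "\<And>d. 0 < d \<Longrightarrow> d < 2 * s \<Longrightarrow> a \<le> jump d" and "0 \<le> a"
    and "0 < s" "2 * s \<le> n" "S \<subseteq> {..<n}" "2 * card S \<le> n"
  defines "A \<equiv> superlevel S (escape S) (real s * a)"
  shows "A = S \<or> s \<le> card A"
proof (cases "\<forall>v\<in>S. card (window n (2 * s) v \<inter> S) \<le> s")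
  case True
  have "v \<in> A" if "v \<in> S" for v
    unfolding A_def superlevel_def using that True assms mem_window_self[of "2 * s" v n]
    by (auto intro!: escape_prob_window_ge[of s a v])
  then show ?thesis
    by (auto simp: A_def superlevel_def)
next
  case False
  then obtain v where "s \<le> card (window n (2 * s) v \<inter> S)"
    by (auto simp: not_le intro: less_imp_le)
  moreover have "2 * s * card S \<le> s * n"
    using assms by simp
  ultimately obtain x where half_full: "card (window n (2 * s) x \<inter> S) = s"
    using assms n_pos ex_card_window_Int_eq[of n "2 * s" S s v] by blast
  then have "window n (2 * s) x \<inter> S \<subseteq> A"
    unfolding A_def superlevel_def using assms by (auto intro!: escape_prob_window_ge[of s a x])
  moreover have "finite A"
    using finite_subset[OF \<open>S \<subseteq> {..<n}\<close>] by (simp add: A_def superlevel_def)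
  ultimately show ?thesis
    using half_full by (metis card_mono)
qed

lemma escape_prob_nonneg: "0 \<le> escape S v"
  unfolding escape_prob_def by (intro sum_nonneg circulant_nonneg)

lemma card_sqrt_escape_prob_superlevel:
  assumes jump_ge: "\<And>d. 0 < d \<Longrightarrow> d < n \<Longrightarrow> c / real d ^ 3 \<le> jump d" and "0 \<le> c"
    and "0 < s" "2 * s \<le> n" "S \<subseteq> {..<n}" "2 * card S \<le> n"
  defines "A \<equiv> superlevel S (\<lambda>v. sqrt (escape S v)) (sqrt (c / 8) / real s)"
  shows "A = S \<or> s \<le> card A"
proof -
  have "real s * (c / (2 * real s) ^ 3) = c / 8 / (real s)\<^sup>2"
    using \<open>0 < s\<close> by (simp add: power_mult_distrib power2_eq_square power3_eq_cube)
  then have sqrt_eq: "sqrt (c / 8) / real s = sqrt (real s * (c / (2 * real s) ^ 3))"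
    by (simp only: real_sqrt_divide real_sqrt_abs abs_of_nat)
  have A: "A = superlevel S (escape S) (real s * (c / (2 * real s) ^ 3))"
    unfolding A_def superlevel_def sqrt_eq real_sqrt_le_iff ..
  have "c / (2 * real s) ^ 3 \<le> jump d" if "0 < d" "d < 2 * s" for d
  proof -
    have "c / (2 * real s) ^ 3 \<le> c / real d ^ 3"
      using that \<open>0 \<le> c\<close> by (intro divide_left_mono power_mono) auto
    also have "\<dots> \<le> jump d"
      using that \<open>2 * s \<le> n\<close> by (intro jump_ge) auto
    finally show ?thesis .
  qed
  moreover have "0 \<le> c / (2 * real s) ^ 3"
    using \<open>0 \<le> c\<close> by simp
  ultimately show ?thesis
    unfolding A using assms(3-6) by (rule card_escape_prob_superlevel)
qed

lemma sum_sqrt_escape_prob_ge: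
  assumes jump_ge: "\<And>d. 0 < d \<Longrightarrow> d < n \<Longrightarrow> c / real d ^ 3 \<le> jump d" and "0 \<le> c"
    and "2 \<le> n" and S: "S \<subseteq> {..<n}" "2 * card S \<le> n"
  shows "sqrt (c / 8) / 2 * (ln (real n) / real n) * real (card S)
    \<le> (\<Sum>v\<in>S. sqrt (escape S v))"
proof (rule sum_ge_ln_if_card_superlevel)
  show "finite S"
    using S finite_subset by blast
  let ?A = "\<lambda>s. superlevel S (\<lambda>v. sqrt (escape S v)) (sqrt (c / 8) / real s)"
  fix s assume "1 \<le> s" "s \<le> floor_sqrt n"
  then show "?A s = S \<or> s \<le> card (?A s)"
    using double_floor_sqrt_le[OF \<open>2 \<le> n\<close>] S
    by (intro card_sqrt_escape_prob_superlevel[OF jump_ge \<open>0 \<le> c\<close>]) auto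
qed (use assms n_pos in \<open>auto simp: escape_prob_nonneg\<close>)

lemma isoperimetric_const_circulant_ge:
  assumes "\<And>d. 0 < d \<Longrightarrow> d < n \<Longrightarrow> c / real d ^ 3 \<le> jump d" "0 \<le> c" "2 \<le> n"
  shows "sqrt (c / 8) / 2 * (ln (real n) / real n)
    \<le> isoperimetric_const (1 / 2) {..<n} (circulant n jump) (\<lambda>_. 1 / real n)"
  using isoperimetric_const_uniform_ge[of "{..<n}" _ "circulant n jump" "1 / 2"]
    sum_sqrt_escape_prob_ge[OF assms] assms
  by (simp add: powr_half_sqrt escape_prob_nonneg)

end

section \<open>The walk with inverse cube jumps\<close>

text \<open>The tail exponent 3 makes the variance of a jump of order \<open>ln n\<close>, while a vertex at
  distance \<open>d\<close> from the end of an arc leaves it with probability of order \<open>1 / d\<^sup>2\<close>. Adding both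
  directions instead of using the cyclic distance makes the symmetry under \<open>d \<mapsto> n - d\<close> evident.\<close>

definition cubic_jump :: "nat \<Rightarrow> nat \<Rightarrow> real" where
  "cubic_jump n d =
     (if d = 0 then 1 - (\<Sum>k=1..<n. 1 / real k ^ 3) / 4
      else (1 / real d ^ 3 + 1 / real (n - d) ^ 3) / 8)"

lemma cubic_jump_reflect: "0 < d \<Longrightarrow> d < n \<Longrightarrow> cubic_jump n (n - d) = cubic_jump n d"
  by (simp add: cubic_jump_def)

lemma cubic_jump_ge: "0 < d \<Longrightarrow> 1 / 8 / real d ^ 3 \<le> cubic_jump n d"
  by (simp add: cubic_jump_def)

lemma cubic_jump_pos: "0 < cubic_jump n d"
proof (cases "d = 0")
  case True
  have "(\<Sum>k=1..<n. 1 / real k ^ 3) \<le> (\<Sum>k=1..n. 1 / real k ^ 3)"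
    by (intro sum_mono2) auto
  also have "\<dots> \<le> 2"
    by (intro sum_inverse_power_le_2) simp
  finally show ?thesis
    by (simp add: cubic_jump_def True)
next
  case False
  then have "0 < 1 / 8 / real d ^ 3"
    by simp
  also have "\<dots> \<le> cubic_jump n d"
    using False by (intro cubic_jump_ge) simp
  finally show ?thesis .
qed

lemma sum_cubic_jump_mult:
  assumes "\<And>d. 0 < d \<Longrightarrow> d < n \<Longrightarrow> F (n - d) = F d"
  shows "(\<Sum>d=1..<n. cubic_jump n d * F d) = (\<Sum>d=1..<n. F d / real d ^ 3) / 4"
proof -
  have "(\<Sum>d=1..<n. cubic_jump n d * F d)
      = (\<Sum>d=1..<n. F d / real d ^ 3 / 8) + (\<Sum>d=1..<n. F (n - d) / real (n - d) ^ 3 / 8)"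
    unfolding sum.distrib[symmetric]
    by (intro sum.cong) (auto simp: cubic_jump_def assms add_divide_distrib algebra_simps)
  also have "\<dots> = 2 * (\<Sum>d=1..<n. F d / real d ^ 3 / 8)"
    by (subst sum_reflect) simp
  also have "\<dots> = (\<Sum>d=1..<n. F d / real d ^ 3) / 4"
    unfolding sum_divide_distrib[symmetric] by simp
  finally show ?thesis .
qed

lemma symmetric_cyclic_walk_cubic_jump:
  assumes "0 < n"
  shows "symmetric_cyclic_walk n (cubic_jump n)"
proof
  show "(\<Sum>d<n. cubic_jump n d) = 1"
    using sum_cubic_jump_mult[of n "\<lambda>_. 1"] assms
    by (simp add: sum_lessThan_head cubic_jump_def[of n 0])
qed (use assms in \<open>auto simp: cubic_jump_reflect less_imp_le[OF cubic_jump_pos]\<close>)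

abbreviation cubic_walk :: "nat \<Rightarrow> nat \<Rightarrow> nat \<Rightarrow> real" where
  "cubic_walk n \<equiv> circulant n (cubic_jump n)"

lemma lambda2_cubic_walk_le:
  assumes "3 \<le> n"
  shows "lambda2 (1\<^sub>m n - transition_mat {..<n} (cubic_walk n)) \<le> 16 * (ln (real n) / (real n)\<^sup>2)"
proof -
  interpret symmetric_cyclic_walk n "cubic_jump n"
    using assms by (intro symmetric_cyclic_walk_cubic_jump) simp
  have harm_le: "harm n \<le> 2 * ln (real n)"
    using harm_le_one_plus_ln[of n] one_le_ln[OF assms] assms by simp
  have "lambda2 (1\<^sub>m n - transition_mat {..<n} (cubic_walk n))
      \<le> (\<Sum>d=1..<n. cubic_jump n d * (1 - cos (turn n d)))"
    using assms cubic_jump_pos[of n 1] by (intro lambda2_circulant_le) auto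
  also have "\<dots> = (\<Sum>d=1..<n. (1 - cos (turn n d)) / real d ^ 3) / 4"
    using cos_turn_mult_reflect[of _ n 1] by (intro sum_cubic_jump_mult) simp
  also have "\<dots> \<le> 2 * pi\<^sup>2 / (real n)\<^sup>2 * harm n / 4"
    by (intro divide_right_mono sum_one_minus_cos_turn_div_cube_le) simp
  also have "\<dots> \<le> 2 * 4\<^sup>2 / (real n)\<^sup>2 * (2 * ln (real n)) / 4"
  proof (intro divide_right_mono mult_mono harm_le)
    show "pi\<^sup>2 \<le> 4\<^sup>2"
      using pi_less_4 by (intro power_mono) auto
  qed (auto simp: harm_nonneg)
  finally show ?thesis
    by simp
qed

lemma isoperimetric_const_cubic_walk:
  assumes "2 \<le> n"
  defines "\<phi> \<equiv> isoperimetric_const (1 / 2) {..<n} (cubic_walk n) (\<lambda>_. 1 / real n)"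
  shows "1 / 16 * (ln (real n) / real n) \<le> \<phi>" "\<phi> < 1"
proof -
  interpret symmetric_cyclic_walk n "cubic_jump n"
    using assms by (intro symmetric_cyclic_walk_cubic_jump) simp
  have "sqrt (1 / 8 / 8) / 2 * (ln (real n) / real n) \<le> \<phi>"
    unfolding \<phi>_def using assms by (intro isoperimetric_const_circulant_ge cubic_jump_ge) auto
  then show "1 / 16 * (ln (real n) / real n) \<le> \<phi>"
    by (simp add: real_sqrt_divide)
  show "\<phi> < 1"
    unfolding \<phi>_def using assms cubic_jump_pos[of n 0]
    by (intro isoperimetric_const_less_1[OF markov_chain_circulant, of 0]) (auto simp: circulant_def)
qed

lemma lambda2_cubic_walk_le_isoperimetric:
  assumes "16 \<le> n"
  defines "\<phi> \<equiv> isoperimetric_const (1 / 2) {..<n} (cubic_walk n) (\<lambda>_. 1 / real n)"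
  shows "lambda2 (1\<^sub>m n - transition_mat {..<n} (cubic_walk n)) \<le> 8192 * (\<phi>\<^sup>2 / ln (1 / \<phi>))"
proof -
  have "lambda2 (1\<^sub>m n - transition_mat {..<n} (cubic_walk n)) \<le> 16 * (ln (real n) / (real n)\<^sup>2)"
    using assms(1) by (intro lambda2_cubic_walk_le) simp
  also have "\<dots> \<le> 16 * (2 / (1 / 16)\<^sup>2 * (\<phi>\<^sup>2 / ln (1 / \<phi>)))"
    unfolding \<phi>_def using assms(1) one_le_ln[of n] isoperimetric_const_cubic_walk[of n]
    by (intro mult_left_mono ln_over_square_le) auto
  also have "\<dots> = 8192 * (\<phi>\<^sup>2 / ln (1 / \<phi>))"
    by (simp add: power2_eq_square)
  finally show ?thesis .
qed

theorem theorem1p4: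
  shows "\<exists>c1>0. \<exists>c2>0. \<exists>C>0. \<forall>N::nat.
    \<exists>(V :: nat set) (P :: nat \<Rightarrow> nat \<Rightarrow> real) (\<pi> :: nat \<Rightarrow> real).
      markov_chain V P \<pi> \<and> irreducible_chain V P \<and> reversible_chain V P \<pi> \<and> N \<le> card V \<and>
      lambda2 (1\<^sub>m (card V) - transition_mat V P)
        \<le> c1 * (ln (real (card V)) / (real (card V))\<^sup>2) \<and>
      isoperimetric_const (1 / 2) V P \<pi> \<ge> c2 * (ln (real (card V)) / real (card V)) \<and>
      lambda2 (1\<^sub>m (card V) - transition_mat V P)
        \<le> C * ((isoperimetric_const (1 / 2) V P \<pi>)\<^sup>2 / ln (1 / isoperimetric_const (1 / 2) V P \<pi>))"
proof (intro exI conjI allI)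
  show "0 < (16::real)" "0 < 1 / (16::real)" "0 < (8192::real)"
    by simp_all
  fix N :: nat
  define n where "n = N + 16"
  then have n: "N \<le> n" "16 \<le> n"
    by simp_all
  let ?P = "cubic_walk n" and ?\<pi> = "\<lambda>_. 1 / real n"
  let ?gap = "lambda2 (1\<^sub>m (card {..<n}) - transition_mat {..<n} ?P)"
  let ?\<phi> = "isoperimetric_const (1 / 2) {..<n} ?P ?\<pi>"
  interpret symmetric_cyclic_walk n "cubic_jump n"
    using n by (intro symmetric_cyclic_walk_cubic_jump) simp
  show "markov_chain {..<n} ?P ?\<pi>" "reversible_chain {..<n} ?P ?\<pi>"
    by (rule markov_chain_circulant reversible_chain_circulant)+
  show "irreducible_chain {..<n} ?P"
    using n cubic_jump_pos by (intro irreducible_chain_circulant) auto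
  show "N \<le> card {..<n}"
    using n by simp
  show "?gap \<le> 16 * (ln (real (card {..<n})) / (real (card {..<n}))\<^sup>2)"
    using n lambda2_cubic_walk_le[of n] by simp
  show "1 / 16 * (ln (real (card {..<n})) / real (card {..<n})) \<le> ?\<phi>"
    using n isoperimetric_const_cubic_walk(1)[of n] by simp
  show "?gap \<le> 8192 * (?\<phi>\<^sup>2 / ln (1 / ?\<phi>))"
    using n lambda2_cubic_walk_le_isoperimetric[of n] by simp
qed

end
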